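(* Let $A\in\mathbb{R}^{m\times n}$, $b\in\mathbb{R}^m$ satisfy the genericity condition $\widetilde\sigma_n>\sigma_{n+1}$, let $x$ be the unique TLS solution, $r=b-Ax$, and let $L\in\mathbb{R}^{k\times n}$, $k\le n$ (with $Lx\ne0$ for the mixed quantities). Let $Q_1=I_n+xx^\top$, $Q=V_{11}D^{-1}V_{11}^\top$, and denote $$\kappa_\infty^{\mathrm U}=\frac{\left\||LQ_1QQ_1|\left|A^\top+\frac{2xr^\top}{1+x^\top x}\right||A||x|\right\|_\infty+\left\||LQ_1QQ_1||A^\top||r|\right\|_\infty+\left\|\left|LQ_1QQ_1\left(A^\top+\frac{2xr^\top}{1+x^\top x}\right)\right||b|\right\|_\infty}{\|Lx\|_\infty},$$ $$\kappa_c^{\mathrm U}=\left\|D_{Lx}^\dagger|LQ_1QQ_1|\left|A^\top+\frac{2xr^\top}{1+x^\top x}\right||A||x|\right\|_\infty+\left\|D_{Lx}^\dagger|LQ_1QQ_1||A^\top||r|\right\|_\infty+\left\|D_{Lx}^\dagger\left|LQ_1QQ_1\left(A^\top+\frac{2xr^\top}{1+x^\top x}\right)\right||b|\right\|_\infty .$$ Then $$\kappa_\infty^{\mathrm{rel}}\le\kappa_\infty^{\mathrm U},\qquad \kappa_c\le\kappa_c^{\mathrm U}.$$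
   Context: Let $m>n$. The total least squares (TLS) problem for $A\in\mathbb{R}^{m\times n}$, $b\in\mathbb{R}^m$ is to minimize $\|[A,b]-[\widehat A,\widehat b]\|_F$ over $[\widehat A,\widehat b]\in\mathbb{R}^{m\times(n+1)}$ with $\widehat b$ in the range of $\widehat A$; any $x$ with $\widehat A x=\widehat b$ for a minimizer is a TLS solution. Let $\widetilde\sigma_n$ be the smallest singular value of $A$ and let $[A,b]=U\Sigma V^\top$ be an SVD with $U\in\mathbb{R}^{m\times m}$, $V\in\mathbb{R}^{(n+1)\times(n+1)}$ orthogonal and singular values $\sigma_1\ge\dots\ge\sigma_{n+1}\ge0$. Under the genericity condition $\widetilde\sigma_n>\sigma_{n+1}$ the TLS solution $x$ is unique and $\begin{bmatrix}x\\-1\end{bmatrix}=-\frac1{v_{n+1,n+1}}v_{n+1}$, where $v_{n+1}$ is the last column of $V$ and $v_{n+1,n+1}$ its last component. $V_{11}$ is the leading $n\times n$ submatrix of $V$ and $D=\mathrm{Diag}(\sigma_1^2-\sigma_{n+1}^2,\dots,\sigma_n^2-\sigma_{n+1}^2)$. The mixed and componentwise condition numbers of $\Psi(A,b)=Lx$ are $$\kappa_\infty^{\mathrm{rel}}=\frac{\| |L\mathcal N|\mathrm{vec}(|A|)+|L\mathcal H||b| \|_\infty}{\|Lx\|_\infty},\qquad \kappa_c=\|D_{Lx}^\dagger(|L\mathcal N|\mathrm{vec}(|A|)+|L\mathcal H||b|)\|_\infty,$$ where $P=A^\top A-\sigma_{n+1}^2I_n$, $\mathcal N=P^{-1}\left[-x^\top\otimes\left(A^\top+\frac{2xr^\top}{1+x^\top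 x}\right)+I_n\otimes r^\top\right]$, $\mathcal H=P^{-1}\left[A^\top+\frac{2xr^\top}{1+x^\top x}\right]$. $|\cdot|$ is the entrywise absolute value, $\otimes$ the Kronecker product $[a_{ij}B]$, $\mathrm{vec}$ stacks columns, $D_{Lx}$ is the diagonal matrix with diagonal $Lx$, and $\dagger$ is the Moore–Penrose inverse. *)

theory Defs
  imports Complex_Main "Jordan_Normal_Form.Matrix" "Jordan_Normal_Form.Gauss_Jordan_Elimination"
begin

text \<open>Real matrices and vectors are those of Jordan-Normal-Form, with explicit dimensions and
  indices starting from 0; thus the entry with subscript \<open>n+1\<close> in the usual notation has index \<open>n\<close>.\<close>

abbreviation abs_mat :: "real mat \<Rightarrow> real mat" where
  "abs_mat M \<equiv> map_mat abs M"

abbreviation abs_vec :: "real vec \<Rightarrow> real vec" where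
  "abs_vec v \<equiv> map_vec abs v"

text \<open>The \<open>0\<close> is inserted only to give vectors of dimension \<open>0\<close> the norm \<open>0\<close>.\<close>

definition inf_norm :: "real vec \<Rightarrow> real" where
  "inf_norm v = Max (insert 0 ((\<lambda>i. \<bar>v $ i\<bar>) ` {..<dim_vec v}))"

definition frobenius_norm :: "real mat \<Rightarrow> real" where
  "frobenius_norm M = sqrt (\<Sum>i<dim_row M. \<Sum>j<dim_col M. (M $$ (i,j))\<^sup>2)"

definition row_mat :: "real vec \<Rightarrow> real mat" where
  "row_mat v = mat_of_rows (dim_vec v) [v]"

definition col_mat :: "real vec \<Rightarrow> real mat" where
  "col_mat v = mat_of_cols (dim_vec v) [v]"

text \<open>The matrix \<open>[A, b]\<close>.\<close>

definition augment :: "real mat \<Rightarrow> real vec \<Rightarrow> real mat" where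
  "augment A b = mat_of_cols (dim_row A) (cols A @ [b])"

definition kron :: "real mat \<Rightarrow> real mat \<Rightarrow> real mat" where
  "kron A B = mat (dim_row A * dim_row B) (dim_col A * dim_col B)
     (\<lambda>(i,j). A $$ (i div dim_row B, j div dim_col B) * B $$ (i mod dim_row B, j mod dim_col B))"

text \<open>Column stacking.\<close>

definition vec_of_mat :: "real mat \<Rightarrow> real vec" where
  "vec_of_mat A = vec (dim_row A * dim_col A) (\<lambda>l. A $$ (l mod dim_row A, l div dim_row A))"

text \<open>Only meaningful for invertible \<open>M\<close>.\<close>

definition inv_mat :: "real mat \<Rightarrow> real mat" where
  "inv_mat M = the (mat_inverse M)"

definition is_moore_penrose :: "real mat \<Rightarrow> real mat \<Rightarrow> bool" where
  "is_moore_penrose M X \<longleftrightarrow> X \<in> carrier_mat (dim_col M) (dim_row M) \<and>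
     M * X * M = M \<and> X * M * X = X \<and>
     transpose_mat (M * X) = M * X \<and> transpose_mat (X * M) = X * M"

definition pinv :: "real mat \<Rightarrow> real mat" where
  "pinv M = (THE X. is_moore_penrose M X)"

definition diag_of_vec :: "real vec \<Rightarrow> real mat" where
  "diag_of_vec v = mat_diag (dim_vec v) (\<lambda>i. v $ i)"

definition leading_submat :: "nat \<Rightarrow> real mat \<Rightarrow> real mat" where
  "leading_submat n M = mat n n (\<lambda>(i,j). M $$ (i,j))"

text \<open>The library predicate \<open>orthogonal_mat\<close> does not ask for columns of norm 1.\<close>

definition is_orthogonal :: "nat \<Rightarrow> real mat \<Rightarrow> bool" where
  "is_orthogonal n Q \<longleftrightarrow> Q \<in> carrier_mat n n \<and>
     transpose_mat Q * Q = 1\<^sub>m n \<and> Q * transpose_mat Q = 1\<^sub>m n"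

definition is_svd :: "real mat \<Rightarrow> real mat \<Rightarrow> real mat \<Rightarrow> real mat \<Rightarrow> bool" where
  "is_svd M U S V \<longleftrightarrow>
     is_orthogonal (dim_row M) U \<and> is_orthogonal (dim_col M) V \<and>
     S \<in> carrier_mat (dim_row M) (dim_col M) \<and>
     (\<forall>i<dim_row M. \<forall>j<dim_col M. i \<noteq> j \<longrightarrow> S $$ (i,j) = 0) \<and>
     (\<forall>i<min (dim_row M) (dim_col M). 0 \<le> S $$ (i,i)) \<and>
     (\<forall>i j. i \<le> j \<longrightarrow> j < min (dim_row M) (dim_col M) \<longrightarrow> S $$ (j,j) \<le> S $$ (i,i)) \<and>
     M = U * S * transpose_mat V"

text \<open>The last diagonal entry of \<open>\<Sigma>\<close> in a singular value decomposition of \<open>M\<close>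
  (every matrix has one, and \<open>\<Sigma>\<close> does not depend on its choice).\<close>

definition is_smallest_singular_value :: "real mat \<Rightarrow> real \<Rightarrow> bool" where
  "is_smallest_singular_value M s \<longleftrightarrow>
     (\<exists>U S V. is_svd M U S V \<and>
       (let p = min (dim_row M) (dim_col M) - 1 in s = S $$ (p,p)))"

definition tls_feasible :: "nat \<Rightarrow> nat \<Rightarrow> real mat \<Rightarrow> real vec \<Rightarrow> bool" where
  "tls_feasible m n Ah bh \<longleftrightarrow> Ah \<in> carrier_mat m n \<and> bh \<in> carrier_vec m \<and>
     bh \<in> (\<lambda>y. Ah *\<^sub>v y) ` carrier_vec n"

definition tls_minimizer :: "real mat \<Rightarrow> real vec \<Rightarrow> real mat \<Rightarrow> real vec \<Rightarrow> bool" where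
  "tls_minimizer A b Ah bh \<longleftrightarrow> tls_feasible (dim_row A) (dim_col A) Ah bh \<and>
     (\<forall>A' b'. tls_feasible (dim_row A) (dim_col A) A' b' \<longrightarrow>
        frobenius_norm (augment A b - augment Ah bh) \<le> frobenius_norm (augment A b - augment A' b'))"

definition tls_solution :: "real mat \<Rightarrow> real vec \<Rightarrow> real vec \<Rightarrow> bool" where
  "tls_solution A b x \<longleftrightarrow> x \<in> carrier_vec (dim_col A) \<and>
     (\<exists>Ah bh. tls_minimizer A b Ah bh \<and> Ah *\<^sub>v x = bh)"

definition residual :: "real mat \<Rightarrow> real vec \<Rightarrow> real vec \<Rightarrow> real vec" where
  "residual A b x = b - A *\<^sub>v x"

text \<open>In the following definitions \<open>\<sigma>\<close> stands for the smallest singular value of \<open>[A, b]\<close>.\<close>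

definition tls_P :: "real mat \<Rightarrow> real \<Rightarrow> real mat" where
  "tls_P A \<sigma> = transpose_mat A * A - \<sigma>\<^sup>2 \<cdot>\<^sub>m 1\<^sub>m (dim_col A)"

text \<open>The matrix \<open>A\<^sup>T + 2 x r\<^sup>T / (1 + x\<^sup>T x)\<close>.\<close>

definition tls_G :: "real mat \<Rightarrow> real vec \<Rightarrow> real vec \<Rightarrow> real mat" where
  "tls_G A b x = transpose_mat A
     + (2 / (1 + x \<bullet> x)) \<cdot>\<^sub>m (col_mat x * row_mat (residual A b x))"

definition tls_N :: "real mat \<Rightarrow> real vec \<Rightarrow> real vec \<Rightarrow> real \<Rightarrow> real mat" where
  "tls_N A b x \<sigma> = inv_mat (tls_P A \<sigma>) *
     (kron (- row_mat x) (tls_G A b x) + kron (1\<^sub>m (dim_col A)) (row_mat (residual A b x)))"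

definition tls_H :: "real mat \<Rightarrow> real vec \<Rightarrow> real vec \<Rightarrow> real \<Rightarrow> real mat" where
  "tls_H A b x \<sigma> = inv_mat (tls_P A \<sigma>) * tls_G A b x"

definition cond_vec :: "real mat \<Rightarrow> real mat \<Rightarrow> real vec \<Rightarrow> real vec \<Rightarrow> real \<Rightarrow> real vec" where
  "cond_vec L A b x \<sigma> =
     abs_mat (L * tls_N A b x \<sigma>) *\<^sub>v vec_of_mat (abs_mat A)
     + abs_mat (L * tls_H A b x \<sigma>) *\<^sub>v abs_vec b"

definition kappa_inf_rel :: "real mat \<Rightarrow> real mat \<Rightarrow> real vec \<Rightarrow> real vec \<Rightarrow> real \<Rightarrow> real" where
  "kappa_inf_rel L A b x \<sigma> = inf_norm (cond_vec L A b x \<sigma>) / inf_norm (L *\<^sub>v x)"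

definition kappa_c :: "real mat \<Rightarrow> real mat \<Rightarrow> real vec \<Rightarrow> real vec \<Rightarrow> real \<Rightarrow> real" where
  "kappa_c L A b x \<sigma> = inf_norm (pinv (diag_of_vec (L *\<^sub>v x)) *\<^sub>v cond_vec L A b x \<sigma>)"

text \<open>\<open>S\<close> and \<open>V\<close> are the factors \<open>\<Sigma>\<close> and \<open>V\<close> of a singular value decomposition of \<open>[A, b]\<close>,
  where \<open>A\<close> has \<open>n\<close> columns.\<close>

definition tls_D :: "nat \<Rightarrow> real mat \<Rightarrow> real mat" where
  "tls_D n S = mat_diag n (\<lambda>i. (S $$ (i,i))\<^sup>2 - (S $$ (n,n))\<^sup>2)"

definition tls_Q1 :: "real vec \<Rightarrow> real mat" where
  "tls_Q1 x = 1\<^sub>m (dim_vec x) + col_mat x * row_mat x"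

definition tls_Q :: "nat \<Rightarrow> real mat \<Rightarrow> real mat \<Rightarrow> real mat" where
  "tls_Q n S V = leading_submat n V * inv_mat (tls_D n S) * transpose_mat (leading_submat n V)"

definition kappa_inf_U ::
    "real mat \<Rightarrow> real mat \<Rightarrow> real vec \<Rightarrow> real vec \<Rightarrow> real mat \<Rightarrow> real mat \<Rightarrow> real" where
  "kappa_inf_U L A b x S V =
    (let r = residual A b x; G = tls_G A b x;
         K = L * tls_Q1 x * tls_Q (dim_col A) S V * tls_Q1 x
     in (inf_norm ((abs_mat K * abs_mat G * abs_mat A) *\<^sub>v abs_vec x)
       + inf_norm ((abs_mat K * abs_mat (transpose_mat A)) *\<^sub>v abs_vec r)
       + inf_norm (abs_mat (K * G) *\<^sub>v abs_vec b)) / inf_norm (L *\<^sub>v x))"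

definition kappa_c_U ::
    "real mat \<Rightarrow> real mat \<Rightarrow> real vec \<Rightarrow> real vec \<Rightarrow> real mat \<Rightarrow> real mat \<Rightarrow> real" where
  "kappa_c_U L A b x S V =
    (let r = residual A b x; G = tls_G A b x;
         K = L * tls_Q1 x * tls_Q (dim_col A) S V * tls_Q1 x;
         Di = pinv (diag_of_vec (L *\<^sub>v x))
     in inf_norm ((Di * abs_mat K * abs_mat G * abs_mat A) *\<^sub>v abs_vec x)
      + inf_norm ((Di * abs_mat K * abs_mat (transpose_mat A)) *\<^sub>v abs_vec r)
      + inf_norm ((Di * abs_mat (K * G)) *\<^sub>v abs_vec b))"

end

theory Submission
  imports Defs "Jordan_Normal_Form.Determinant" "HOL-Analysis.L2_Norm"
begin

text \<open>Write \<open>\<sigma> = \<sigma>\<^bsub>n+1\<^esub>\<close>, \<open>v\<close> for the last column of \<open>V\<close>, \<open>\<alpha>\<close> for the last entry of \<open>v\<close>,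
  and \<open>W = V\<^bsub>11\<^esub>\<close>. The bounds follow from the triangle inequality once the matrix \<open>P\<^sup>-\<^sup>1\<close> in the
  condition numbers is identified with \<open>Q\<^sub>1 Q Q\<^sub>1\<close>, which removes the difference
  \<open>P = A\<^sup>T A - \<sigma>\<^sup>2 I\<close>. The identity \<open>P\<^sup>-\<^sup>1 = Q\<^sub>1 Q Q\<^sub>1\<close> rests on three facts.
  
  First, \<open>P = W D W\<^sup>T\<close>: the matrix \<open>A\<^sup>T A\<close> is the leading block of
  \<open>[A, b]\<^sup>T [A, b] = V \<Sigma>\<^sup>T \<Sigma> V\<^sup>T\<close>, and subtracting \<open>\<sigma>\<^sup>2 V V\<^sup>T\<close> cancels the contribution of \<open>v\<close>
  (\<open>P_eq\<close>). The smallest singular value of \<open>A\<close> exceeds \<open>\<sigma>\<close>, so \<open>P\<close> is positive definite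
  (\<open>det_P\<close>). By multiplicativity of determinants \<open>W\<close> and \<open>D\<close> are invertible, so \<open>D\<close> has a
  positive diagonal (\<open>D_pos\<close>); and \<open>\<alpha> \<noteq> 0\<close>, since otherwise \<open>W\<^sup>T\<close> would annihilate the first
  \<open>n\<close> entries of \<open>v\<close> (\<open>V_corner_nonzero\<close>).
  
  Secondly, a TLS solution \<open>x\<close> satisfies \<open>v = -\<alpha> [x; -1]\<close> (\<open>tls_solution_eq\<close>). Subtracting
  \<open>[A, b] v v\<^sup>T\<close> from \<open>[A, b]\<close> gives a consistent system at distance \<open>\<sigma>\<close>, so a minimizer is
  within distance \<open>\<sigma>\<close>. The minimizer maps \<open>z = [x; -1]\<close> to \<open>0\<close>, so \<open>[A, b] z\<close> has Euclidean
  norm at most \<open>\<sigma>\<close> times that of \<open>z\<close>. In the coordinates \<open>V\<^sup>T z\<close> this says that a sum with the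
  positive weights of \<open>D\<close> is not positive, hence \<open>z\<close> is a multiple of \<open>v\<close>.
  
  Thirdly, orthonormality of the rows of \<open>V\<close> gives
  \<open>W W\<^sup>T = I - \<alpha>\<^sup>2 x x\<^sup>T\<close> with \<open>\<alpha>\<^sup>2 (1 + x\<^sup>T x) = 1\<close>, which is the inverse of \<open>Q\<^sub>1\<close>
  (\<open>Q1_W_WT\<close>). Therefore \<open>W\<^sup>-\<^sup>1 = W\<^sup>T Q\<^sub>1\<close>, and inverting \<open>W D W\<^sup>T\<close> gives
  \<open>Q\<^sub>1 W D\<^sup>-\<^sup>1 W\<^sup>T Q\<^sub>1\<close> (\<open>inv_P\<close>).
  
  With \<open>K = L P\<^sup>-\<^sup>1\<close>, the entry of \<open>L \<N>\<close> that multiplies the \<open>(p,j)\<close> entry of \<open>A\<close> in row \<open>i\<close> is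
  \<open>-x\<^sub>j (K G)\<^bsub>ip\<^esub> + K\<^bsub>ij\<^esub> r\<^sub>p\<close>, where \<open>G = A\<^sup>T + 2 x r\<^sup>T / (1 + x\<^sup>T x)\<close>. Taking absolute
  values termwise yields the componentwise bound \<open>abs_cond_vec_le\<close>. It survives multiplication of
  each component by a scalar, hence by the pseudoinverse of a diagonal matrix, and the norm of the
  sum of three vectors is at most the sum of their norms.\<close>

section \<open>Singular values and Frobenius norms\<close>

lemma index_mult_mat_sum:
  assumes "X \<in> carrier_mat p q" and "Y \<in> carrier_mat q s" and "i < p" and "j < s"
  shows "(X * Y) $$ (i,j) = (\<Sum>l\<in>{0..<q}. X $$ (i,l) * Y $$ (l,j))"
  using assms by (simp add: scalar_prod_def)

lemma sq_norm_vec_nonneg: "0 \<le> (v :: real vec) \<bullet> v"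
  by (simp add: scalar_prod_def sum_nonneg)

lemma sq_norm_vec_pos:
  assumes "(v :: real vec) \<in> carrier_vec n" and "v \<noteq> 0\<^sub>v n"
  shows "0 < v \<bullet> v"
proof -
  obtain i where i: "i < n" "v $ i \<noteq> 0"
    using assms by (metis carrier_vecD eq_vecI index_zero_vec(1) index_zero_vec(2))
  have "0 < (\<Sum>j\<in>{0..<n}. v $ j * v $ j)"
    by (rule sum_pos2[of _ i]) (use i in \<open>auto simp: zero_less_mult_iff linorder_neq_iff\<close>)
  then show ?thesis
    using assms(1) by (simp add: scalar_prod_def)
qed

lemma is_orthogonal_transpose: "is_orthogonal N Q \<Longrightarrow> is_orthogonal N (transpose_mat Q)"
  by (auto simp: is_orthogonal_def)

lemma orthogonal_inner:
  assumes "is_orthogonal N Q" and y: "y \<in> carrier_vec N" and z: "z \<in> carrier_vec N"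
  shows "(Q *\<^sub>v y) \<bullet> (Q *\<^sub>v z) = y \<bullet> z"
proof -
  have Q: "Q \<in> carrier_mat N N" and QQ: "transpose_mat Q * Q = 1\<^sub>m N"
    using assms(1) by (auto simp: is_orthogonal_def)
  have "(Q *\<^sub>v y) \<bullet> (Q *\<^sub>v z) = (transpose_mat Q *\<^sub>v (Q *\<^sub>v y)) \<bullet> z"
    using transpose_vec_mult_scalar[OF Q z, of "Q *\<^sub>v y"] Q y by simp
  also have "transpose_mat Q *\<^sub>v (Q *\<^sub>v y) = (transpose_mat Q * Q) *\<^sub>v y"
    using Q y by simp
  finally show ?thesis using QQ y by simp
qed

text \<open>The singular values act as weights on the coordinates with respect to the columns of \<open>V\<close>. The
  bilinear form, rather than the norm alone, is what gives the entries of \<open>M\<^sup>T M\<close> when applied to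
  unit vectors.\<close>

lemma svd_inner:
  assumes svd: "is_svd M U S V" and M: "M \<in> carrier_mat m N" and Nm: "N \<le> m"
    and y: "y \<in> carrier_vec N" and z: "z \<in> carrier_vec N"
  shows "(M *\<^sub>v y) \<bullet> (M *\<^sub>v z) =
    (\<Sum>l<N. (S $$ (l,l))\<^sup>2 * ((transpose_mat V *\<^sub>v y) $ l * (transpose_mat V *\<^sub>v z) $ l))"
proof -
  have U: "is_orthogonal m U" "U \<in> carrier_mat m m" and V: "V \<in> carrier_mat N N"
    and S: "S \<in> carrier_mat m N"
    and S0: "\<And>i j. i < m \<Longrightarrow> j < N \<Longrightarrow> i \<noteq> j \<Longrightarrow> S $$ (i,j) = 0"
    and eq: "M = U * S * transpose_mat V"
    using svd M by (auto simp: is_svd_def is_orthogonal_def)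
  have My: "M *\<^sub>v u = U *\<^sub>v (S *\<^sub>v (transpose_mat V *\<^sub>v u))" if "u \<in> carrier_vec N" for u
    unfolding eq using U S V that
    by (simp add: assoc_mult_mat_vec[of _ m N _ N] assoc_mult_mat_vec[of _ m m _ N])
  have Sw: "(S *\<^sub>v w) $ i = (if i < N then S $$ (i,i) * w $ i else 0)"
    if w: "w \<in> carrier_vec N" and i: "i < m" for w i
  proof -
    have "(S *\<^sub>v w) $ i = (\<Sum>j\<in>{0..<N}. S $$ (i,j) * w $ j)"
      using S w i by (simp add: scalar_prod_def)
    also have "\<dots> = (\<Sum>j\<in>{0..<N}. if j = i then S $$ (i,i) * w $ i else 0)"
      by (rule sum.cong) (use S0 i in auto)
    finally show ?thesis by simp
  qed
  define u where "u = transpose_mat V *\<^sub>v y"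
  define w where "w = transpose_mat V *\<^sub>v z"
  have uw: "u \<in> carrier_vec N" "w \<in> carrier_vec N"
    using V y z by (auto simp: u_def w_def)
  have "(M *\<^sub>v y) \<bullet> (M *\<^sub>v z) = (S *\<^sub>v u) \<bullet> (S *\<^sub>v w)"
    unfolding My[OF y] My[OF z] u_def[symmetric] w_def[symmetric]
    by (rule orthogonal_inner[OF U(1)]) (use S uw in auto)
  also have "\<dots> = (\<Sum>i\<in>{0..<m}. (S *\<^sub>v u) $ i * (S *\<^sub>v w) $ i)"
    using S unfolding scalar_prod_def by simp
  also have "\<dots> = (\<Sum>i\<in>{0..<m}. if i < N then (S $$ (i,i))\<^sup>2 * (u $ i * w $ i) else 0)"
    by (rule sum.cong) (auto simp: Sw[OF uw(1)] Sw[OF uw(2)] power2_eq_square)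
  also have "\<dots> = (\<Sum>i\<in>{0..<m} \<inter> {i. i < N}. (S $$ (i,i))\<^sup>2 * (u $ i * w $ i))"
    by (simp add: sum.inter_restrict)
  also have "{0..<m} \<inter> {i. i < N} = {..<N}" using Nm by auto
  finally show ?thesis by (simp add: u_def w_def)
qed

text \<open>Every weight in \<open>svd_inner\<close> is at least the last one, as the singular values decrease.\<close>

lemma smallest_singular_value_bound:
  assumes "is_smallest_singular_value A s" and A: "A \<in> carrier_mat m n" and n: "1 \<le> n" "n \<le> m"
    and y: "y \<in> carrier_vec n"
  shows "s\<^sup>2 * (y \<bullet> y) \<le> (A *\<^sub>v y) \<bullet> (A *\<^sub>v y)"
proof -
  obtain U S V where svd: "is_svd A U S V" and s: "s = S $$ (n - 1, n - 1)"
    using assms(1) A n by (auto simp: is_smallest_singular_value_def Let_def min_def)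
  have V: "is_orthogonal n V" "V \<in> carrier_mat n n"
    and mono: "\<And>i j. i \<le> j \<Longrightarrow> j < n \<Longrightarrow> S $$ (j,j) \<le> S $$ (i,i)"
    and pos: "\<And>i. i < n \<Longrightarrow> 0 \<le> S $$ (i,i)"
    using svd A n by (auto simp: is_svd_def is_orthogonal_def min_def)
  define w where "w = transpose_mat V *\<^sub>v y"
  have "y \<bullet> y = w \<bullet> w"
    unfolding w_def using orthogonal_inner[OF is_orthogonal_transpose[OF V(1)] y y] by simp
  also have "\<dots> = (\<Sum>l<n. w $ l * w $ l)"
    using V by (simp add: scalar_prod_def w_def lessThan_atLeast0)
  finally have "s\<^sup>2 * (y \<bullet> y) = (\<Sum>l<n. s\<^sup>2 * (w $ l * w $ l))"
    by (simp add: sum_distrib_left)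
  also have "\<dots> \<le> (\<Sum>l<n. (S $$ (l,l))\<^sup>2 * (w $ l * w $ l))"
    by (intro sum_mono mult_right_mono power_mono) (use n mono pos in \<open>auto simp: s\<close>)
  also have "\<dots> = (A *\<^sub>v y) \<bullet> (A *\<^sub>v y)"
    unfolding w_def by (rule svd_inner[OF svd A n(2) y y, symmetric])
  finally show ?thesis .
qed

lemma frobenius_norm_nonneg: "0 \<le> frobenius_norm E"
  by (simp add: frobenius_norm_def sum_nonneg)

lemma Cauchy_Schwarz_sum:
  fixes f g :: "'a \<Rightarrow> real"
  shows "(\<Sum>i\<in>I. f i * g i)\<^sup>2 \<le> (\<Sum>i\<in>I. (f i)\<^sup>2) * (\<Sum>i\<in>I. (g i)\<^sup>2)"
proof -
  have "\<bar>\<Sum>i\<in>I. f i * g i\<bar> \<le> (\<Sum>i\<in>I. \<bar>f i\<bar> * \<bar>g i\<bar>)"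
    unfolding abs_mult[symmetric] by (rule sum_abs)
  also have "\<dots> \<le> L2_set f I * L2_set g I" by (rule L2_set_mult_ineq)
  finally have "(\<Sum>i\<in>I. f i * g i)\<^sup>2 \<le> (L2_set f I * L2_set g I)\<^sup>2"
    by (rule abs_le_square_iff[THEN iffD1, OF order_trans, OF _ abs_ge_self])
  then show ?thesis by (simp add: power_mult_distrib L2_set_def sum_nonneg)
qed

text \<open>Cauchy--Schwarz in each row: the Frobenius norm dominates the spectral norm.\<close>

lemma sq_norm_mult_le_frobenius:
  assumes "E \<in> carrier_mat m N" and z: "z \<in> carrier_vec N"
  shows "(E *\<^sub>v z) \<bullet> (E *\<^sub>v z) \<le> (frobenius_norm E)\<^sup>2 * (z \<bullet> z)"
proof -
  have "(E *\<^sub>v z) \<bullet> (E *\<^sub>v z) = (\<Sum>i<m. (\<Sum>j<N. E $$ (i,j) * z $ j)\<^sup>2)"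
    using assms by (simp add: scalar_prod_def power2_eq_square lessThan_atLeast0)
  also have "\<dots> \<le> (\<Sum>i<m. (\<Sum>j<N. (E $$ (i,j))\<^sup>2) * (\<Sum>j<N. (z $ j)\<^sup>2))"
    by (intro sum_mono Cauchy_Schwarz_sum)
  also have "\<dots> = (frobenius_norm E)\<^sup>2 * (z \<bullet> z)"
    using assms by (simp add: frobenius_norm_def sum_nonneg scalar_prod_def power2_eq_square
        lessThan_atLeast0 sum_distrib_right)
  finally show ?thesis .
qed

section \<open>Inverses and pseudoinverses\<close>

lemma inv_mat_eqI:
  assumes M: "M \<in> carrier_mat n n" and X: "X \<in> carrier_mat n n" and MX: "M * X = 1\<^sub>m n"
  shows "inv_mat M = X"
proof -
  have XM: "X * M = 1\<^sub>m n" by (rule mat_mult_left_right_inverse[OF M X MX])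
  have "M \<in> Units (ring_mat TYPE(real) n ())"
    using M X MX XM by (auto simp: Units_def ring_mat_def)
  then obtain B where B: "mat_inverse M = Some B" using mat_inverse(1)[OF M, of "()"] by (cases "mat_inverse M") auto
  then have B': "B * M = 1\<^sub>m n" "B \<in> carrier_mat n n" using mat_inverse(2)[OF M B] by auto
  have "B = B * (M * X)" using B' MX by simp
  also have "\<dots> = B * M * X" by (rule assoc_mult_mat[OF B'(2) M X, symmetric])
  also have "\<dots> = X" unfolding B'(1) using X by simp
  finally show ?thesis using B by (simp add: inv_mat_def)
qed

text \<open>The symmetric idempotents \<open>M X\<close> and \<open>M Y\<close> have the same range, so they coincide, and so do
  \<open>X M\<close> and \<open>Y M\<close>; then \<open>X = X M X = Y M X = Y M Y = Y\<close>.\<close>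

lemma moore_penrose_unique:
  assumes X: "is_moore_penrose M X" and Y: "is_moore_penrose M Y"
  shows "X = Y"
proof -
  define p q where "p = dim_row M" and "q = dim_col M"
  have M: "M \<in> carrier_mat p q" and Xc: "X \<in> carrier_mat q p" and Yc: "Y \<in> carrier_mat q p"
    using X Y by (auto simp: is_moore_penrose_def p_def q_def)
  note ac = M Xc Yc
  have "M * Y * (M * X) = M * Y * M * X"
    using ac by (intro assoc_mult_mat[symmetric]) auto
  then have MX: "M * X = M * Y * (M * X)" using Y by (simp add: is_moore_penrose_def)
  have "M * X * (M * Y) = M * X * M * Y"
    using ac by (intro assoc_mult_mat[symmetric]) auto
  then have MY: "M * Y = M * X * (M * Y)" using X by (simp add: is_moore_penrose_def)
  have "M * X = transpose_mat (M * X)" using X by (simp add: is_moore_penrose_def)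
  also have "\<dots> = transpose_mat (M * X) * transpose_mat (M * Y)"
    by (subst MX, rule transpose_mult) (use ac in auto)
  also have "\<dots> = M * Y" using X Y MY by (simp add: is_moore_penrose_def)
  finally have 1: "M * X = M * Y" .
  have "X * M * (Y * M) = X * (M * Y * M)"
    using ac by (simp add: assoc_mult_mat[of _ q p _ q _ q] assoc_mult_mat[of _ p q _ p _ q])
  then have XM: "X * M = X * M * (Y * M)" using Y by (simp add: is_moore_penrose_def)
  have "Y * M * (X * M) = Y * (M * X * M)"
    using ac by (simp add: assoc_mult_mat[of _ q p _ q _ q] assoc_mult_mat[of _ p q _ p _ q])
  then have YM: "Y * M = Y * M * (X * M)" using X by (simp add: is_moore_penrose_def)
  have "X * M = transpose_mat (X * M)" using X by (simp add: is_moore_penrose_def)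
  also have "\<dots> = transpose_mat (Y * M) * transpose_mat (X * M)"
    by (subst XM, rule transpose_mult) (use ac in auto)
  also have "\<dots> = Y * M" using X Y YM by (simp add: is_moore_penrose_def)
  finally have 2: "X * M = Y * M" .
  have "X = X * M * X" using X by (simp add: is_moore_penrose_def)
  also have "\<dots> = Y * (M * X)" unfolding 2 using ac by (simp add: assoc_mult_mat)
  also have "\<dots> = Y * M * Y" unfolding 1 using ac by (simp add: assoc_mult_mat)
  also have "\<dots> = Y" using Y by (simp add: is_moore_penrose_def)
  finally show ?thesis .
qed

text \<open>The convention \<open>inverse 0 = 0\<close> is exactly what the pseudoinverse does to zero diagonal entries.\<close>

lemma pinv_diag_of_vec:
  "pinv (diag_of_vec v) = mat_diag (dim_vec v) (\<lambda>i. inverse (v $ i))"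
proof -
  have sym: "transpose_mat (mat_diag n f) = mat_diag n f" for n and f :: "nat \<Rightarrow> real"
    by (rule eq_matI) (auto simp: mat_diag_def)
  have "is_moore_penrose (diag_of_vec v) (mat_diag (dim_vec v) (\<lambda>i. inverse (v $ i)))"
    unfolding is_moore_penrose_def diag_of_vec_def mat_diag_diag sym
    by (auto simp: mat_diag_def intro!: eq_matI) (use right_inverse left_inverse in blast)+
  then show ?thesis unfolding pinv_def
    by (intro the_equality) (auto intro: moore_penrose_unique)
qed

lemma mat_diag_mult_vec_index:
  assumes "i < k" and "u \<in> carrier_vec k"
  shows "(mat_diag k d *\<^sub>v u) $ i = d i * (u $ i :: real)"
proof -
  have "(mat_diag k d *\<^sub>v u) $ i = (\<Sum>j\<in>{0..<k}. if j = i then d i * u $ i else 0)"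
    using assms by (simp add: mat_diag_def scalar_prod_def if_distrib[of "\<lambda>c. c * _"] cong: if_cong)
  then show ?thesis using assms by simp
qed

section \<open>The maximum norm\<close>

lemma abs_le_inf_norm: "i < dim_vec v \<Longrightarrow> \<bar>v $ i\<bar> \<le> inf_norm v"
  unfolding inf_norm_def by (rule Max_ge) auto

lemma inf_norm_nonneg: "0 \<le> inf_norm v"
  unfolding inf_norm_def by (rule Max_ge) auto

lemma inf_norm_le_sum3:
  assumes dims: "dim_vec c = k" "dim_vec u = k" "dim_vec v = k" "dim_vec w = k"
    and le: "\<And>i. i < k \<Longrightarrow> \<bar>c $ i\<bar> \<le> \<bar>u $ i\<bar> + \<bar>v $ i\<bar> + \<bar>w $ i\<bar>"
  shows "inf_norm c \<le> inf_norm u + inf_norm v + inf_norm w"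
proof -
  have "\<bar>c $ i\<bar> \<le> inf_norm u + inf_norm v + inf_norm w" if "i < k" for i
    using le[OF that] abs_le_inf_norm[of i u] abs_le_inf_norm[of i v] abs_le_inf_norm[of i w]
      dims that by linarith
  then show ?thesis
    using inf_norm_nonneg[of u] inf_norm_nonneg[of v] inf_norm_nonneg[of w] dims
    unfolding inf_norm_def[of c] by (intro Max.boundedI) auto
qed

section \<open>Generic total least squares problems\<close>

lemma augment_index:
  assumes "A \<in> carrier_mat m n" and "b \<in> carrier_vec m"
  shows "augment A b \<in> carrier_mat m (Suc n)"
    and "i < m \<Longrightarrow> j \<le> n \<Longrightarrow> augment A b $$ (i,j) = (if j < n then A $$ (i,j) else b $ i)"
  using assms by (auto simp: augment_def mat_of_cols_index nth_append)

lemma augment_mult_vec: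
  assumes A: "A \<in> carrier_mat m n" and b: "b \<in> carrier_vec m" and z: "z \<in> carrier_vec (Suc n)"
    and i: "i < m"
  shows "(augment A b *\<^sub>v z) $ i = (\<Sum>j<n. A $$ (i,j) * z $ j) + b $ i * z $ n"
  using augment_index[OF A b] A b z i
  by (simp add: scalar_prod_def lessThan_atLeast0[symmetric])

locale generic_tls =
  fixes m n :: nat and A U S V :: "real mat" and b :: "real vec" and \<sigma>A :: real
  assumes n: "1 \<le> n" and nm: "n < m"
    and A: "A \<in> carrier_mat m n" and b: "b \<in> carrier_vec m"
    and svd: "is_svd (augment A b) U S V"
    and sv: "is_smallest_singular_value A \<sigma>A"
    and generic: "\<sigma>A > S $$ (n,n)"
begin

abbreviation "\<sigma> \<equiv> S $$ (n,n)"
abbreviation "W \<equiv> leading_submat n V"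
abbreviation "M \<equiv> augment A b"

lemma M: "M \<in> carrier_mat m (Suc n)"
  by (rule augment_index[OF A b])

lemma V: "is_orthogonal (Suc n) V" "V \<in> carrier_mat (Suc n) (Suc n)"
  using svd M by (auto simp: is_svd_def is_orthogonal_def)

lemma W: "W \<in> carrier_mat n n"
  by (simp add: leading_submat_def)

lemma D: "tls_D n S \<in> carrier_mat n n"
  by (simp add: tls_D_def)

lemma sigma_bounds: "l \<le> n \<Longrightarrow> \<sigma> \<le> S $$ (l,l)" "0 \<le> \<sigma>"
  using svd M nm by (auto simp: is_svd_def)

lemma V_rows:
  assumes "i \<le> n" "j \<le> n"
  shows "(\<Sum>l<Suc n. V $$ (i,l) * V $$ (j,l)) = (if i = j then 1 else 0)"
proof -
  have "(V * transpose_mat V) $$ (i,j) = (1\<^sub>m (Suc n) :: real mat) $$ (i,j)"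
    using V(1) by (simp add: is_orthogonal_def)
  then show ?thesis
    using assms V(2) by (simp add: scalar_prod_def lessThan_atLeast0 del: sum.op_ivl_Suc sum.lessThan_Suc)
qed

lemma V_cols:
  assumes "i \<le> n" "j \<le> n"
  shows "(\<Sum>l<Suc n. V $$ (l,i) * V $$ (l,j)) = (if i = j then 1 else 0)"
proof -
  have "(transpose_mat V * V) $$ (i,j) = (1\<^sub>m (Suc n) :: real mat) $$ (i,j)"
    using V(1) by (simp add: is_orthogonal_def)
  then show ?thesis
    using assms V(2) by (simp add: scalar_prod_def lessThan_atLeast0 del: sum.op_ivl_Suc sum.lessThan_Suc)
qed

text \<open>Splitting off the smallest singular value leaves the quadratic form with matrix \<open>D\<close> in the
  first \<open>n\<close> coordinates. It measures how far \<open>z\<close> is from being a multiple of the last column of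
  \<open>V\<close>.\<close>

lemma sq_norm_M:
  assumes z: "z \<in> carrier_vec (Suc n)"
  shows "(M *\<^sub>v z) \<bullet> (M *\<^sub>v z) = \<sigma>\<^sup>2 * (z \<bullet> z) +
    (\<Sum>l<n. ((S $$ (l,l))\<^sup>2 - \<sigma>\<^sup>2) * ((transpose_mat V *\<^sub>v z) $ l)\<^sup>2)"
proof -
  define w where "w = transpose_mat V *\<^sub>v z"
  have "(M *\<^sub>v z) \<bullet> (M *\<^sub>v z) = (\<Sum>l<Suc n. (S $$ (l,l))\<^sup>2 * (w $ l * w $ l))"
    unfolding w_def by (rule svd_inner[OF svd M _ z z]) (use nm in simp)
  moreover have "z \<bullet> z = (\<Sum>l<Suc n. w $ l * w $ l)"
    using orthogonal_inner[OF is_orthogonal_transpose[OF V(1)] z z] V(2)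
    by (simp add: scalar_prod_def w_def lessThan_atLeast0 del: sum.op_ivl_Suc sum.lessThan_Suc)
  ultimately show ?thesis unfolding w_def[symmetric]
    by (simp add: algebra_simps sum_subtractf sum_distrib_left power2_eq_square)
qed

lemma gram_index:
  assumes ij: "i < n" "j < n"
  shows "(transpose_mat A * A) $$ (i,j) = (\<Sum>l<Suc n. (S $$ (l,l))\<^sup>2 * (V $$ (i,l) * V $$ (j,l)))"
proof -
  have col: "M *\<^sub>v unit_vec (Suc n) j = col A j" if "j < n" for j
    by (rule eq_vecI) (use that A M augment_index(2)[OF A b] in auto)
  have row: "(transpose_mat V *\<^sub>v unit_vec (Suc n) j) $ l = V $$ (j,l)" if "j < n" "l < Suc n" for j l
    using that V(2) by simp
  have "(transpose_mat A * A) $$ (i,j) = col A i \<bullet> col A j"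
    using ij A by simp
  also have "\<dots> = (M *\<^sub>v unit_vec (Suc n) i) \<bullet> (M *\<^sub>v unit_vec (Suc n) j)"
    using ij by (simp add: col)
  also have "\<dots> = (\<Sum>l<Suc n. (S $$ (l,l))\<^sup>2 *
      ((transpose_mat V *\<^sub>v unit_vec (Suc n) i) $ l * (transpose_mat V *\<^sub>v unit_vec (Suc n) j) $ l))"
    by (rule svd_inner[OF svd M]) (use nm in auto)
  also have "\<dots> = (\<Sum>l<Suc n. (S $$ (l,l))\<^sup>2 * (V $$ (i,l) * V $$ (j,l)))"
    by (rule sum.cong) (use ij row in auto)
  finally show ?thesis .
qed

text \<open>The last column of \<open>V\<close> drops out because its weight is \<open>\<sigma>\<^sup>2 - \<sigma>\<^sup>2 = 0\<close>; only the leading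
  block of \<open>V\<close> remains.\<close>

lemma P_eq: "tls_P A \<sigma> = W * tls_D n S * transpose_mat W"
proof (rule eq_matI)
  show dims: "dim_row (tls_P A \<sigma>) = dim_row (W * tls_D n S * transpose_mat W)"
    "dim_col (tls_P A \<sigma>) = dim_col (W * tls_D n S * transpose_mat W)"
    using A W by (auto simp: tls_P_def)
  fix i j
  assume "i < dim_row (W * tls_D n S * transpose_mat W)"
    and "j < dim_col (W * tls_D n S * transpose_mat W)"
  then have ij: "i < n" "j < n" using W by auto
  have "tls_P A \<sigma> $$ (i,j) = (transpose_mat A * A) $$ (i,j) - \<sigma>\<^sup>2 * (if i = j then 1 else 0)"
    using ij A by (simp add: tls_P_def)
  also have "\<dots> = (\<Sum>l<n. ((S $$ (l,l))\<^sup>2 - \<sigma>\<^sup>2) * (V $$ (i,l) * V $$ (j,l)))"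
    using gram_index[OF ij] V_rows[of i j, symmetric] ij
    by (simp add: algebra_simps sum_subtractf sum_distrib_left del: mult_cancel_left)
  also have "\<dots> = (W * tls_D n S * transpose_mat W) $$ (i,j)"
    unfolding tls_D_def mat_diag_mult_right[OF W]
    using ij by (simp add: scalar_prod_def leading_submat_def lessThan_atLeast0 mult_ac)
  finally show "tls_P A \<sigma> $$ (i,j) = (W * tls_D n S * transpose_mat W) $$ (i,j)" .
qed

lemma P_carrier: "tls_P A \<sigma> \<in> carrier_mat n n"
  using A by (auto simp: tls_P_def)

text \<open>A kernel vector \<open>y\<close> of \<open>P\<close> would have \<open>A y\<close> of squared norm \<open>\<sigma>\<^sup>2 (y \<bullet> y)\<close>, less than the
  smallest singular value of \<open>A\<close> permits.\<close>

lemma det_P: "det (tls_P A \<sigma>) \<noteq> 0"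
proof
  assume "det (tls_P A \<sigma>) = 0"
  then obtain y where y: "y \<in> carrier_vec n" "y \<noteq> 0\<^sub>v n" and Py: "tls_P A \<sigma> *\<^sub>v y = 0\<^sub>v n"
    using det_0_iff_vec_prod_zero[OF P_carrier] by blast
  define G where "G = transpose_mat A * A"
  have G: "G \<in> carrier_mat n n" using A by (simp add: G_def)
  have "transpose_mat A *\<^sub>v (A *\<^sub>v y) = G *\<^sub>v y"
    using A y by (simp add: G_def)
  also have "\<dots> = \<sigma>\<^sup>2 \<cdot>\<^sub>v y"
  proof (rule eq_vecI)
    fix i assume "i < dim_vec (\<sigma>\<^sup>2 \<cdot>\<^sub>v y)"
    then have i: "i < n" using y by simp
    have "0 = (tls_P A \<sigma> *\<^sub>v y) $ i" using Py i by simp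
    also have "\<dots> = (\<Sum>j\<in>{0..<n}. tls_P A \<sigma> $$ (i,j) * y $ j)"
      using P_carrier i y by (simp add: scalar_prod_def)
    also have "\<dots> = (\<Sum>j\<in>{0..<n}. G $$ (i,j) * y $ j - (if j = i then \<sigma>\<^sup>2 * y $ i else 0))"
      using A G i by (intro sum.cong) (auto simp: tls_P_def G_def[symmetric] left_diff_distrib)
    also have "\<dots> = (G *\<^sub>v y) $ i - \<sigma>\<^sup>2 * y $ i"
      using G i y by (simp add: sum_subtractf scalar_prod_def)
    finally show "(G *\<^sub>v y) $ i = (\<sigma>\<^sup>2 \<cdot>\<^sub>v y) $ i"
      using i y by simp
  qed (use G y in auto)
  finally have "(A *\<^sub>v y) \<bullet> (A *\<^sub>v y) = \<sigma>\<^sup>2 * (y \<bullet> y)"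
    using transpose_vec_mult_scalar[OF A y(1), of "A *\<^sub>v y"] A y by simp
  moreover have "\<sigma>A\<^sup>2 * (y \<bullet> y) \<le> (A *\<^sub>v y) \<bullet> (A *\<^sub>v y)"
    by (rule smallest_singular_value_bound[OF sv A n _ y(1)]) (use nm in simp)
  moreover have "\<sigma>\<^sup>2 < \<sigma>A\<^sup>2"
    using generic sigma_bounds(2) by (simp add: power_strict_mono)
  ultimately show False
    using sq_norm_vec_pos[OF y] by (simp add: mult_le_cancel_right)
qed

lemma det_W: "det W \<noteq> 0" and det_D: "det (tls_D n S) \<noteq> 0"
proof -
  have "det (tls_P A \<sigma>) = det W * det (tls_D n S) * det W"
    unfolding P_eq using W D by (simp add: det_mult[of _ n] det_transpose[of _ n])
  then show "det W \<noteq> 0" and "det (tls_D n S) \<noteq> 0" using det_P by auto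
qed

text \<open>The genericity condition compares \<open>\<sigma>\<close> with the smallest singular value of \<open>A\<close>, not with the
  other singular values of \<open>[A, b]\<close>. The strict gap in the latter is deduced here from the
  invertibility of \<open>P = W D W\<^sup>T\<close>, in place of interlacing.\<close>

lemma D_pos:
  assumes "l < n"
  shows "\<sigma>\<^sup>2 < (S $$ (l,l))\<^sup>2"
proof -
  have "upper_triangular (tls_D n S)" by (auto simp: tls_D_def mat_diag_def)
  then have "det (tls_D n S) = prod_list (diag_mat (tls_D n S))"
    by (rule det_upper_triangular[OF _ D])
  also have "\<dots> = (\<Prod>i\<in>{0..<n}. (S $$ (i,i))\<^sup>2 - \<sigma>\<^sup>2)"
    by (simp add: prod_list_diag_prod tls_D_def mat_diag_def)
  finally have "(S $$ (l,l))\<^sup>2 - \<sigma>\<^sup>2 \<noteq> 0"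
    using det_D assms by auto
  moreover have "\<sigma>\<^sup>2 \<le> (S $$ (l,l))\<^sup>2"
    using sigma_bounds assms by (intro power_mono) auto
  ultimately show ?thesis by simp
qed

text \<open>If the corner entry vanished, orthogonality of the columns of \<open>V\<close> would put the rest of the
  last column, a unit vector, into the kernel of the transpose of the invertible block \<open>W\<close>.\<close>

lemma V_corner_nonzero: "V $$ (n,n) \<noteq> 0"
proof
  assume 0: "V $$ (n,n) = 0"
  define v where "v = vec n (\<lambda>i. V $$ (i,n))"
  have "transpose_mat W *\<^sub>v v = 0\<^sub>v n"
  proof (rule eq_vecI)
    fix l assume "l < dim_vec (0\<^sub>v n)"
    then show "(transpose_mat W *\<^sub>v v) $ l = 0\<^sub>v n $ l"
      using V_cols[of l n] 0
      by (simp add: leading_submat_def scalar_prod_def v_def lessThan_atLeast0)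
  qed (simp add: leading_submat_def)
  moreover have "v \<noteq> 0\<^sub>v n"
  proof
    assume "v = 0\<^sub>v n"
    then have "V $$ (i,n) = 0" if "i < n" for i
      using that by (metis index_vec index_zero_vec(1) v_def)
    then show False using V_cols[of n n] 0 by simp
  qed
  ultimately have "det (transpose_mat W) = 0"
    by (intro det_0_iff_vec_prod_zero[of _ n, THEN iffD2] exI[of _ v] conjI)
      (use W in \<open>auto simp: v_def\<close>)
  then show False using det_W W by (simp add: det_transpose[of _ n])
qed

end

section \<open>The solution and the smallest singular vector\<close>

context generic_tls
begin

lemma V_col_n:
  defines "v \<equiv> col V n"
  shows "v \<in> carrier_vec (Suc n)" and "v \<bullet> v = 1" and "(M *\<^sub>v v) \<bullet> (M *\<^sub>v v) = \<sigma>\<^sup>2"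
proof -
  show v: "v \<in> carrier_vec (Suc n)" unfolding v_def using V(2) by (metis carrier_matD(1) col_dim)
  have coord: "(transpose_mat V *\<^sub>v v) $ l = (if l = n then 1 else 0)" if "l < Suc n" for l
    using V_cols[of l n] that V(2)
    by (simp add: v_def scalar_prod_def lessThan_atLeast0 del: sum.op_ivl_Suc sum.lessThan_Suc)
  show vv: "v \<bullet> v = 1"
    using V_cols[of n n] V(2)
    by (simp add: v_def scalar_prod_def lessThan_atLeast0 del: sum.op_ivl_Suc sum.lessThan_Suc)
  show "(M *\<^sub>v v) \<bullet> (M *\<^sub>v v) = \<sigma>\<^sup>2"
    using sq_norm_M[OF v] vv coord by simp
qed

text \<open>The competitor is \<open>[A, b] - [A, b] v v\<^sup>T\<close>, with \<open>v\<close> the last column of \<open>V\<close>. It annihilates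
  \<open>v\<close>, whose last entry is nonzero, so the corresponding system is solvable; and
  \<open>[A, b] v v\<^sup>T\<close> has Frobenius norm \<open>\<sigma>\<close>.\<close>

lemma tls_distance_le:
  assumes min: "tls_minimizer A b Ah bh"
  shows "(frobenius_norm (augment A b - augment Ah bh))\<^sup>2 \<le> \<sigma>\<^sup>2"
proof -
  define v where "v = col V n"
  define q where "q = M *\<^sub>v v"
  define \<alpha> where "\<alpha> = V $$ (n,n)"
  have \<alpha>: "\<alpha> \<noteq> 0" using V_corner_nonzero by (simp add: \<alpha>_def)
  have v: "v \<in> carrier_vec (Suc n)" and vv: "v \<bullet> v = 1" and qq: "q \<bullet> q = \<sigma>\<^sup>2"
    using V_col_n by (simp_all add: v_def q_def)
  have v\<alpha>: "v $ n = \<alpha>" using V(2) by (simp add: v_def \<alpha>_def)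
  have q: "q \<in> carrier_vec m" using M v by (simp add: q_def)
  have q_eq: "q $ i = (\<Sum>j<n. A $$ (i,j) * v $ j) + b $ i * \<alpha>" if "i < m" for i
    unfolding q_def using augment_mult_vec[OF A b v that] v\<alpha> by simp
  have vsum: "(\<Sum>j<n. v $ j * v $ j) = 1 - \<alpha> * \<alpha>"
    using vv v v\<alpha> by (simp add: scalar_prod_def lessThan_atLeast0[symmetric])
  define A' where "A' = mat m n (\<lambda>(i,j). A $$ (i,j) - q $ i * v $ j)"
  define b' where "b' = vec m (\<lambda>i. b $ i - q $ i * \<alpha>)"
  have A': "A' \<in> carrier_mat m n" and b': "b' \<in> carrier_vec m" by (auto simp: A'_def b'_def)
  \<comment> \<open>the multiple of \<open>v\<close> with last entry \<open>-1\<close>, without that entry\<close>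
  define y where "y = vec n (\<lambda>j. - v $ j / \<alpha>)"
  have "A' *\<^sub>v y = b'"
  proof (rule eq_vecI)
    fix i assume "i < dim_vec b'"
    then have i: "i < m" by (simp add: b'_def)
    have "(A' *\<^sub>v y) $ i = (\<Sum>j<n. (A $$ (i,j) - q $ i * v $ j) * (- v $ j / \<alpha>))"
      using i by (simp add: A'_def y_def scalar_prod_def lessThan_atLeast0)
    also have "\<dots> = - ((\<Sum>j<n. A $$ (i,j) * v $ j) - q $ i * (\<Sum>j<n. v $ j * v $ j)) / \<alpha>"
      unfolding sum_distrib_left sum_subtractf[symmetric] sum_negf[symmetric] sum_divide_distrib
      by (rule sum.cong) (use \<alpha> in \<open>auto simp: field_simps\<close>)
    also have "\<dots> = - ((q $ i - b $ i * \<alpha>) - q $ i * (1 - \<alpha> * \<alpha>)) / \<alpha>"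
      unfolding vsum using q_eq[OF i] by simp
    also have "\<dots> = b $ i - q $ i * \<alpha>"
      using \<alpha> by (simp add: field_simps)
    finally show "(A' *\<^sub>v y) $ i = b' $ i" using i by (simp add: b'_def)
  qed (simp add: A'_def b'_def)
  then have "tls_feasible m n A' b'"
    unfolding tls_feasible_def using A' b' by (auto simp: y_def intro!: image_eqI[of _ _ y])
  then have le: "frobenius_norm (augment A b - augment Ah bh) \<le> frobenius_norm (augment A b - augment A' b')"
    using min A by (auto simp: tls_minimizer_def)
  have entry: "(augment A b - augment A' b') $$ (i,j) = q $ i * v $ j" if "i < m" "j < Suc n" for i j
    using that augment_index[OF A b] augment_index[OF A' b'] v\<alpha>
    by (auto simp: A'_def b'_def less_Suc_eq)
  have "(frobenius_norm (augment A b - augment A' b'))\<^sup>2 = (\<Sum>i<m. \<Sum>j<Suc n. (q $ i * v $ j)\<^sup>2)"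
    using augment_index(1)[OF A b] augment_index(1)[OF A' b'] entry
    by (simp add: frobenius_norm_def sum_nonneg del: sum.lessThan_Suc)
  also have "\<dots> = (q \<bullet> q) * (v \<bullet> v)"
    using q v by (simp add: scalar_prod_def sum_product power2_eq_square lessThan_atLeast0 mult_ac
        del: sum.op_ivl_Suc)
  finally have "(frobenius_norm (augment A b - augment A' b'))\<^sup>2 = \<sigma>\<^sup>2"
    by (simp add: qq vv)
  then show ?thesis using le power_mono[OF le frobenius_norm_nonneg, of 2] by simp
qed

text \<open>A minimizer \<open>[Ah, bh]\<close> annihilates \<open>z = [x; -1]\<close>, so \<open>[A, b] z\<close> equals \<open>E z\<close> for the
  correction \<open>E\<close>, whose Frobenius norm is at most \<open>\<sigma>\<close>. Then the form in \<open>sq_norm_M\<close> cannot be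
  positive at \<open>z\<close>, which forces \<open>z\<close> to be a multiple of the last column of \<open>V\<close>.\<close>

lemma tls_solution_eq:
  assumes sol: "tls_solution A b x" and i: "i < n"
  shows "V $$ (i,n) = - V $$ (n,n) * x $ i"
proof -
  obtain Ah bh where min: "tls_minimizer A b Ah bh" and Ax: "Ah *\<^sub>v x = bh"
    and x: "x \<in> carrier_vec n"
    using sol A by (auto simp: tls_solution_def)
  have Ah: "Ah \<in> carrier_mat m n" and bh: "bh \<in> carrier_vec m"
    using min A by (auto simp: tls_minimizer_def tls_feasible_def)
  define z where "z = vec (Suc n) (\<lambda>j. if j < n then x $ j else - 1)"
  define w where "w = transpose_mat V *\<^sub>v z"
  have z: "z \<in> carrier_vec (Suc n)" by (simp add: z_def)
  have w: "w \<in> carrier_vec (Suc n)" using V z by (simp add: w_def)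
  define E where "E = augment A b - augment Ah bh"
  note aug = augment_index(1)[OF A b] augment_index(1)[OF Ah bh]
  have E: "E \<in> carrier_mat m (Suc n)" using aug by (auto simp: E_def)
  have "(augment Ah bh *\<^sub>v z) $ i = 0" if i: "i < m" for i
  proof -
    have "(Ah *\<^sub>v x) $ i = (\<Sum>j<n. Ah $$ (i,j) * x $ j)"
      using Ah x i by (simp add: scalar_prod_def lessThan_atLeast0)
    then show ?thesis
      unfolding augment_mult_vec[OF Ah bh z i] using Ax by (simp add: z_def)
  qed
  then have "augment Ah bh *\<^sub>v z = 0\<^sub>v m"
    using aug by (intro eq_vecI) auto
  then have Ez: "E *\<^sub>v z = M *\<^sub>v z"
    unfolding E_def using aug z by (simp add: minus_mult_distrib_mat_vec)
  have "(M *\<^sub>v z) \<bullet> (M *\<^sub>v z) \<le> (frobenius_norm E)\<^sup>2 * (z \<bullet> z)"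
    unfolding Ez[symmetric] by (rule sq_norm_mult_le_frobenius[OF E z])
  also have "\<dots> \<le> \<sigma>\<^sup>2 * (z \<bullet> z)"
    unfolding E_def by (intro mult_right_mono tls_distance_le[OF min] sq_norm_vec_nonneg)
  finally have le0: "(\<Sum>l<n. ((S $$ (l,l))\<^sup>2 - \<sigma>\<^sup>2) * (w $ l)\<^sup>2) \<le> 0"
    using sq_norm_M[OF z] by (simp add: w_def)
  have nonneg: "0 \<le> ((S $$ (l,l))\<^sup>2 - \<sigma>\<^sup>2) * (w $ l)\<^sup>2" if "l < n" for l
    using D_pos[OF that] by simp
  then have "(\<Sum>l<n. ((S $$ (l,l))\<^sup>2 - \<sigma>\<^sup>2) * (w $ l)\<^sup>2) = 0"
    using le0 by (intro antisym sum_nonneg) auto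
  then have "\<forall>l\<in>{..<n}. ((S $$ (l,l))\<^sup>2 - \<sigma>\<^sup>2) * (w $ l)\<^sup>2 = 0"
    using nonneg by (subst (asm) sum_nonneg_eq_0_iff) auto
  then have w0: "w $ l = 0" if "l < n" for l
    using D_pos[OF that] that by (metis diff_gt_0_iff_gt lessThan_iff less_irrefl mult_eq_0_iff power_eq_0_iff)
  have "V *\<^sub>v w = (V * transpose_mat V) *\<^sub>v z"
    unfolding w_def using V z by simp
  then have Vw: "V *\<^sub>v w = z" using V(1) z by (simp add: is_orthogonal_def)
  have zc: "z $ j = V $$ (j,n) * w $ n" if "j \<le> n" for j
  proof -
    have "z $ j = (V *\<^sub>v w) $ j" by (simp add: Vw)
    then show ?thesis
      using V(2) w that w0 by (simp add: scalar_prod_def lessThan_atLeast0[symmetric])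
  qed
  have "V $$ (n,n) * w $ n = - 1" using zc[of n] by (simp add: z_def)
  moreover have "V $$ (n,n) * x $ i = V $$ (i,n) * (V $$ (n,n) * w $ n)"
    using zc[of i] i by (simp add: z_def)
  ultimately show ?thesis by simp
qed

section \<open>The inverse of P\<close>

lemma W_WT_index:
  assumes sol: "tls_solution A b x" and ij: "i < n" "j < n"
  shows "(W * transpose_mat W) $$ (i,j) =
    (if i = j then 1 else 0) - (V $$ (n,n))\<^sup>2 * (x $ i * x $ j)"
proof -
  have "(\<Sum>l<n. V $$ (i,l) * V $$ (j,l)) = (if i = j then 1 else 0) - V $$ (i,n) * V $$ (j,n)"
    using V_rows[of i j] ij by simp
  then show ?thesis
    using ij tls_solution_eq[OF sol]
    by (simp add: leading_submat_def scalar_prod_def lessThan_atLeast0 power2_eq_square)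
qed

text \<open>This is the Sherman--Morrison formula for \<open>I + x x\<^sup>T\<close>: the unit norm of the last column of
  \<open>V\<close> says that the square of its corner entry is \<open>1 / (1 + x\<^sup>T x)\<close>.\<close>

lemma Q1_W_WT:
  assumes sol: "tls_solution A b x"
  shows "tls_Q1 x * (W * transpose_mat W) = 1\<^sub>m n"
proof (rule eq_matI)
  have x: "x \<in> carrier_vec n" using sol A by (auto simp: tls_solution_def)
  have Q1: "tls_Q1 x \<in> carrier_mat n n"
    using x by (auto simp: tls_Q1_def col_mat_def row_mat_def)
  show "dim_row (tls_Q1 x * (W * transpose_mat W)) = dim_row (1\<^sub>m n)"
    "dim_col (tls_Q1 x * (W * transpose_mat W)) = dim_col (1\<^sub>m n)"
    using Q1 W by auto
  define c where "c = (V $$ (n,n))\<^sup>2"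
  have "(\<Sum>l<n. V $$ (l,n) * V $$ (l,n)) + c = 1"
    using V_cols[of n n] by (simp add: c_def power2_eq_square)
  moreover have "(\<Sum>l<n. V $$ (l,n) * V $$ (l,n)) = (\<Sum>l<n. c * (x $ l * x $ l))"
    by (rule sum.cong) (simp_all add: tls_solution_eq[OF sol] c_def power2_eq_square)
  ultimately have c: "c * (\<Sum>l<n. x $ l * x $ l) + c = 1"
    by (simp add: sum_distrib_left)
  fix i j assume "i < dim_row (1\<^sub>m n)" "j < dim_col (1\<^sub>m n)"
  then have ij: "i < n" "j < n" by auto
  have Q1_index: "tls_Q1 x $$ (i,l) = (if i = l then 1 else 0) + x $ i * x $ l" if "l < n" for l
    using ij that x by (simp add: tls_Q1_def col_mat_def row_mat_def scalar_prod_def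
        mat_of_cols_index mat_of_rows_index)
  have "W * transpose_mat W \<in> carrier_mat n n" using W by simp
  then have "(tls_Q1 x * (W * transpose_mat W)) $$ (i,j) =
      (\<Sum>l\<in>{0..<n}. tls_Q1 x $$ (i,l) * (W * transpose_mat W) $$ (l,j))"
    by (rule index_mult_mat_sum[OF Q1 _ ij])
  also have "\<dots> = (\<Sum>l\<in>{0..<n}. (if l = i then (if i = j then 1 else 0) - c * (x $ i * x $ j) else 0)
      + (if l = j then x $ i * x $ j else 0) - x $ i * x $ j * (c * (x $ l * x $ l)))"
    by (rule sum.cong) (auto simp: Q1_index W_WT_index[OF sol _ ij(2)] c_def[symmetric] algebra_simps)
  also have "\<dots> = (if i = j then 1 else 0) - c * (x $ i * x $ j) + x $ i * x $ j
      - x $ i * x $ j * (c * (\<Sum>l<n. x $ l * x $ l))"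
    using ij by (simp add: sum.distrib sum_subtractf sum_distrib_left lessThan_atLeast0)
  also have "\<dots> = (if i = j then 1 else 0)"
  proof -
    have eq: "c * (\<Sum>l<n. x $ l * x $ l) = 1 - c" using c by simp
    show ?thesis unfolding eq by (simp add: algebra_simps)
  qed
  finally show "(tls_Q1 x * (W * transpose_mat W)) $$ (i,j) = 1\<^sub>m n $$ (i,j)"
    using ij by simp
qed

lemma inv_D:
  "inv_mat (tls_D n S) \<in> carrier_mat n n" "tls_D n S * inv_mat (tls_D n S) = 1\<^sub>m n"
proof -
  define X where "X = mat_diag n (\<lambda>i. inverse ((S $$ (i,i))\<^sup>2 - \<sigma>\<^sup>2))"
  have X: "X \<in> carrier_mat n n" by (simp add: X_def)
  have DX: "tls_D n S * X = 1\<^sub>m n"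
    unfolding tls_D_def X_def mat_diag_diag
    by (rule eq_matI) (use D_pos in \<open>fastforce simp: mat_diag_def\<close>)+
  show "inv_mat (tls_D n S) \<in> carrier_mat n n" "tls_D n S * inv_mat (tls_D n S) = 1\<^sub>m n"
    using inv_mat_eqI[OF D X DX] X DX by simp_all
qed

text \<open>Since \<open>W\<^sup>T Q\<^sub>1\<close> is a two-sided inverse of \<open>W\<close>, the factors of
  \<open>W D W\<^sup>T Q\<^sub>1 W D\<^sup>-\<^sup>1 W\<^sup>T Q\<^sub>1\<close> cancel from the inside out.\<close>

lemma inv_P:
  assumes sol: "tls_solution A b x"
  shows "inv_mat (tls_P A \<sigma>) = tls_Q1 x * tls_Q n S V * tls_Q1 x"
    and "tls_Q1 x \<in> carrier_mat n n" and "tls_Q n S V \<in> carrier_mat n n"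
proof -
  define R where "R = tls_Q1 x"
  define T where "T = transpose_mat W"
  define B where "B = inv_mat (tls_D n S)"
  have x: "x \<in> carrier_vec n" using sol A by (auto simp: tls_solution_def)
  show R': "tls_Q1 x \<in> carrier_mat n n"
    using x by (auto simp: tls_Q1_def col_mat_def row_mat_def)
  then have R: "R \<in> carrier_mat n n" by (simp add: R_def)
  have T: "T \<in> carrier_mat n n" using W by (simp add: T_def)
  have B: "B \<in> carrier_mat n n" and DB: "tls_D n S * B = 1\<^sub>m n" using inv_D by (simp_all add: B_def)
  have Q: "tls_Q n S V = W * B * T" by (simp add: tls_Q_def B_def T_def)
  then show "tls_Q n S V \<in> carrier_mat n n" using W B T by simp
  have "R * (W * T) = 1\<^sub>m n" using Q1_W_WT[OF sol] by (simp add: R_def T_def)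
  then have "W * T * R = 1\<^sub>m n"
    by (intro mat_mult_left_right_inverse[OF R]) (use W T in auto)
  then have WTR: "W * (T * R) = 1\<^sub>m n" using W T R by (simp add: assoc_mult_mat)
  then have TRW: "T * R * W = 1\<^sub>m n"
    by (intro mat_mult_left_right_inverse[OF W]) (use T R in auto)
  note assoc = assoc_mult_mat[of _ n n _ n _ n]
  \<comment> \<open>bracketed so that the factors to be cancelled are adjacent\<close>
  have "tls_P A \<sigma> * (R * tls_Q n S V * R) = W * (tls_D n S * ((T * R * W) * (B * (T * R))))"
    unfolding P_eq Q T_def[symmetric] using W D T R B by (simp add: assoc)
  also have "\<dots> = W * ((tls_D n S * B) * (T * R))"
    unfolding TRW using D T R B by (simp add: assoc)
  also have "\<dots> = 1\<^sub>m n" unfolding DB using WTR T R by simp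
  finally have "tls_P A \<sigma> * (R * tls_Q n S V * R) = 1\<^sub>m n" .
  then show "inv_mat (tls_P A \<sigma>) = tls_Q1 x * tls_Q n S V * tls_Q1 x"
    unfolding R_def[symmetric]
    by (intro inv_mat_eqI[OF P_carrier]) (use R Q W B T in auto)
qed

end

section \<open>Componentwise bounds\<close>

text \<open>For an \<open>m\<close> by \<open>n\<close> matrix, position \<open>j * m + p\<close> of the vector of stacked columns holds the
  entry in row \<open>p\<close> and column \<open>j\<close>.\<close>

lemma sum_nat_mult_eq_double_sum:
  fixes f :: "nat \<Rightarrow> 'a :: comm_monoid_add"
  shows "sum f {..<n * m} = (\<Sum>j<n. \<Sum>p<m. f (j * m + p))"
  unfolding sum.nat_group[symmetric]
proof (rule sum.cong)
  show "sum f {j * m..<j * m + m} = (\<Sum>p<m. f (j * m + p))" for j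
    by (subst sum.atLeastLessThan_shift_0) (simp add: lessThan_atLeast0 comp_def)
qed simp

lemma mult_add_less:
  fixes j m n p :: nat
  assumes "j < n" and "p < m"
  shows "j * m + p < n * m"
proof -
  have "j * m + p < Suc j * m" using assms(2) by simp
  also have "\<dots> \<le> n * m" using assms(1) by (intro mult_right_mono) auto
  finally show ?thesis .
qed

text \<open>The Kronecker products unfold to \<open>-x\<^sub>j (K G)\<^bsub>ip\<^esub> + K\<^bsub>ij\<^esub> r\<^sub>p\<close> as coefficient of the
  \<open>(p,j)\<close> entry of \<open>A\<close>. The triangle inequality separates the two terms and replaces \<open>K G\<close> by
  \<open>|K| |G|\<close>; in the part that involves \<open>b\<close> there is nothing to estimate. With absolute
  values on the right, the inequality is invariant under scaling components by numbers of either
  sign, such as the reciprocals of the entries of \<open>L x\<close>.\<close>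

lemma abs_cond_vec_le:
  assumes A: "A \<in> carrier_mat m n" and b: "b \<in> carrier_vec m" and x: "x \<in> carrier_vec n"
    and L: "L \<in> carrier_mat k n" and Pi: "inv_mat (tls_P A \<sigma>) \<in> carrier_mat n n"
    and K: "K = L * inv_mat (tls_P A \<sigma>)" and i: "i < k"
  defines "r \<equiv> residual A b x" and "G \<equiv> tls_G A b x"
  shows "\<bar>cond_vec L A b x \<sigma> $ i\<bar> \<le> \<bar>((abs_mat K * abs_mat G * abs_mat A) *\<^sub>v abs_vec x) $ i\<bar>
    + \<bar>((abs_mat K * abs_mat (transpose_mat A)) *\<^sub>v abs_vec r) $ i\<bar>
    + \<bar>(abs_mat (K * G) *\<^sub>v abs_vec b) $ i\<bar>"
proof -
  have r: "r \<in> carrier_vec m" using A b by (intro carrier_vecI) (simp add: r_def residual_def)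
  have G: "G \<in> carrier_mat n m"
    using A x r by (auto simp: G_def r_def tls_G_def col_mat_def row_mat_def)
  have Kc: "K \<in> carrier_mat k n" using L Pi by (simp add: K)
  define Z where "Z = kron (- row_mat x) G + kron (1\<^sub>m n) (row_mat r)"
  have Z: "Z \<in> carrier_mat n (n * m)"
    using x r G by (auto simp: Z_def kron_def row_mat_def)
  have LN: "L * tls_N A b x \<sigma> = K * Z"
    using L Pi Z A unfolding K tls_N_def Z_def G_def r_def by (simp add: assoc_mult_mat)
  have LH: "L * tls_H A b x \<sigma> = K * G"
    using L Pi G unfolding K tls_H_def G_def by (simp add: assoc_mult_mat)
  have Z_index: "Z $$ (a, j * m + p) = - x $ j * G $$ (a,p) + (if a = j then r $ p else 0)"
    if "a < n" "j < n" "p < m" for a j p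
  proof -
    have "j * m + p < n * m"
      using that by (intro mult_add_less)
    then show ?thesis
      using that x r G by (simp add: Z_def kron_def row_mat_def mat_of_rows_index)
  qed
  \<comment> \<open>the \<open>(i,p)\<close> entry of \<open>|K| |G|\<close>\<close>
  define g where "g p = (\<Sum>a<n. \<bar>K $$ (i,a)\<bar> * \<bar>G $$ (a,p)\<bar>)" for p
  have KZ: "\<bar>(K * Z) $$ (i, j * m + p)\<bar> \<le> \<bar>x $ j\<bar> * g p + \<bar>K $$ (i,j)\<bar> * \<bar>r $ p\<bar>"
    if jp: "j < n" "p < m" for j p
  proof -
    have "j * m + p < n * m"
      using jp by (intro mult_add_less)
    then have "(K * Z) $$ (i, j * m + p) = (\<Sum>a<n. K $$ (i,a) * Z $$ (a, j * m + p))"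
      using Kc Z i by (simp add: scalar_prod_def lessThan_atLeast0)
    also have "\<dots> = (\<Sum>a<n. - x $ j * (K $$ (i,a) * G $$ (a,p)) + (if a = j then K $$ (i,j) * r $ p else 0))"
    proof (rule sum.cong)
      fix a assume "a \<in> {..<n}"
      then have Z: "Z $$ (a, j * m + p) = - x $ j * G $$ (a,p) + (if a = j then r $ p else 0)"
        using jp by (intro Z_index) auto
      show "K $$ (i,a) * Z $$ (a, j * m + p) =
          - x $ j * (K $$ (i,a) * G $$ (a,p)) + (if a = j then K $$ (i,j) * r $ p else 0)"
        unfolding Z by (simp add: algebra_simps)
    qed simp
    also have "\<dots> = - x $ j * (\<Sum>a<n. K $$ (i,a) * G $$ (a,p)) + K $$ (i,j) * r $ p"
      using jp by (simp add: sum.distrib sum_distrib_left del: mult_minus_left)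
    finally have "\<bar>(K * Z) $$ (i, j * m + p)\<bar> \<le>
        \<bar>x $ j\<bar> * \<bar>\<Sum>a<n. K $$ (i,a) * G $$ (a,p)\<bar> + \<bar>K $$ (i,j)\<bar> * \<bar>r $ p\<bar>"
      using abs_triangle_ineq[of "- x $ j * (\<Sum>a<n. K $$ (i,a) * G $$ (a,p))" "K $$ (i,j) * r $ p"]
      by (simp add: abs_mult)
    moreover have "\<bar>\<Sum>a<n. K $$ (i,a) * G $$ (a,p)\<bar> \<le> g p"
      unfolding g_def abs_mult[symmetric] by (rule sum_abs)
    ultimately show ?thesis
      using mult_left_mono[of "\<bar>\<Sum>a<n. K $$ (i,a) * G $$ (a,p)\<bar>" "g p" "\<bar>x $ j\<bar>"] by linarith
  qed
  have N_eq: "(abs_mat (K * Z) *\<^sub>v vec_of_mat (abs_mat A)) $ i =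
    (\<Sum>j<n. \<Sum>p<m. \<bar>(K * Z) $$ (i, j * m + p)\<bar> * \<bar>A $$ (p,j)\<bar>)"
  proof -
    have "(abs_mat (K * Z) *\<^sub>v vec_of_mat (abs_mat A)) $ i =
        (\<Sum>l<n * m. \<bar>(K * Z) $$ (i,l)\<bar> * vec_of_mat (abs_mat A) $ l)"
      using Kc Z i A by (simp add: scalar_prod_def lessThan_atLeast0 vec_of_mat_def mult.commute)
    also have "\<dots> = (\<Sum>j<n. \<Sum>p<m. \<bar>(K * Z) $$ (i, j * m + p)\<bar> * \<bar>A $$ (p,j)\<bar>)"
      unfolding sum_nat_mult_eq_double_sum
    proof (intro sum.cong refl)
      fix j p assume "j \<in> {..<n}" "p \<in> {..<m}"
      moreover from this have "p + j * m < m * n"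
        using mult_add_less[of j n p m] by (simp add: add.commute mult.commute)
      ultimately show "\<bar>(K * Z) $$ (i, j * m + p)\<bar> * vec_of_mat (abs_mat A) $ (j * m + p) =
          \<bar>(K * Z) $$ (i, j * m + p)\<bar> * \<bar>A $$ (p,j)\<bar>"
        using A by (simp add: vec_of_mat_def add.commute)
    qed
    finally show ?thesis .
  qed
  have N_le: "(abs_mat (K * Z) *\<^sub>v vec_of_mat (abs_mat A)) $ i \<le>
    ((abs_mat K * abs_mat G * abs_mat A) *\<^sub>v abs_vec x) $ i
    + ((abs_mat K * abs_mat (transpose_mat A)) *\<^sub>v abs_vec r) $ i"
  proof -
    note N_eq
    also have "\<dots> \<le> (\<Sum>j<n. \<Sum>p<m. (\<bar>x $ j\<bar> * g p + \<bar>K $$ (i,j)\<bar> * \<bar>r $ p\<bar>) * \<bar>A $$ (p,j)\<bar>)"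
      by (intro sum_mono mult_right_mono KZ) auto
    also have "\<dots> = (\<Sum>j<n. (\<Sum>p<m. g p * \<bar>A $$ (p,j)\<bar>) * \<bar>x $ j\<bar>)
        + (\<Sum>j<n. \<Sum>p<m. \<bar>K $$ (i,j)\<bar> * \<bar>A $$ (p,j)\<bar> * \<bar>r $ p\<bar>)"
      by (simp add: sum.distrib sum_distrib_left sum_distrib_right algebra_simps)
    also have "(\<Sum>j<n. (\<Sum>p<m. g p * \<bar>A $$ (p,j)\<bar>) * \<bar>x $ j\<bar>) =
        ((abs_mat K * abs_mat G * abs_mat A) *\<^sub>v abs_vec x) $ i"
    proof -
      define X where "X = abs_mat K * abs_mat G"
      define Y where "Y = X * abs_mat A"
      have X: "X \<in> carrier_mat k m" and Y: "Y \<in> carrier_mat k n"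
        using Kc G A by (simp_all add: X_def Y_def)
      have "X $$ (i,p) = g p" if "p < m" for p
        unfolding X_def g_def using Kc G i that
        by (subst index_mult_mat_sum[of _ k n _ m]) (auto simp: lessThan_atLeast0)
      then have "Y $$ (i,j) = (\<Sum>p<m. g p * \<bar>A $$ (p,j)\<bar>)" if "j < n" for j
        unfolding Y_def using X A i that
        by (subst index_mult_mat_sum[of _ k m _ n]) (auto simp: lessThan_atLeast0)
      then have "(Y *\<^sub>v abs_vec x) $ i = (\<Sum>j<n. (\<Sum>p<m. g p * \<bar>A $$ (p,j)\<bar>) * \<bar>x $ j\<bar>)"
        using Y x i by (simp add: scalar_prod_def lessThan_atLeast0)
      then show ?thesis by (simp only: X_def Y_def)
    qed
    also have "(\<Sum>j<n. \<Sum>p<m. \<bar>K $$ (i,j)\<bar> * \<bar>A $$ (p,j)\<bar> * \<bar>r $ p\<bar>) =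
        ((abs_mat K * abs_mat (transpose_mat A)) *\<^sub>v abs_vec r) $ i"
      using Kc A r i by (simp add: scalar_prod_def lessThan_atLeast0 sum_distrib_left mult.assoc)
    finally show ?thesis .
  qed
  have "cond_vec L A b x \<sigma> $ i = (abs_mat (K * Z) *\<^sub>v vec_of_mat (abs_mat A)) $ i
      + (abs_mat (K * G) *\<^sub>v abs_vec b) $ i"
    unfolding cond_vec_def LN LH using Kc i by (simp add: index_add_vec)
  moreover have "0 \<le> (abs_mat (K * Z) *\<^sub>v vec_of_mat (abs_mat A)) $ i"
    unfolding N_eq by (simp add: sum_nonneg)
  moreover have "0 \<le> (abs_mat (K * G) *\<^sub>v abs_vec b) $ i"
    using Kc G b i by (simp add: scalar_prod_def sum_nonneg)
  ultimately show ?thesis using N_le by linarith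
qed

theorem corollary3p5:
  fixes m n k :: nat and A L U S V :: "real mat" and b x :: "real vec" and \<sigma>A :: real
  assumes "1 \<le> n" and "n < m" and "k \<le> n"
    and "A \<in> carrier_mat m n" and "b \<in> carrier_vec m" and "L \<in> carrier_mat k n"
    and "is_svd (augment A b) U S V"
    and "is_smallest_singular_value A \<sigma>A"
    and "\<sigma>A > S $$ (n,n)"
    and "tls_solution A b x"
  shows "(L *\<^sub>v x \<noteq> 0\<^sub>v k \<longrightarrow>
           kappa_inf_rel L A b x (S $$ (n,n)) \<le> kappa_inf_U L A b x S V)
       \<and> kappa_c L A b x (S $$ (n,n)) \<le> kappa_c_U L A b x S V"
proof -
  interpret generic_tls m n A U S V b \<sigma>A
    by unfold_locales (use assms in auto)
  note L = \<open>L \<in> carrier_mat k n\<close> and sol = \<open>tls_solution A b x\<close>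
  have x: "x \<in> carrier_vec n" using sol A by (auto simp: tls_solution_def)
  define r where "r = residual A b x"
  define G where "G = tls_G A b x"
  define K where "K = L * tls_Q1 x * tls_Q n S V * tls_Q1 x"
  have r: "r \<in> carrier_vec m" using A b by (intro carrier_vecI) (simp add: r_def residual_def)
  have G: "G \<in> carrier_mat n m"
    using A x r by (auto simp: G_def r_def tls_G_def col_mat_def row_mat_def)
  have Pi: "inv_mat (tls_P A \<sigma>) \<in> carrier_mat n n"
    using inv_P[OF sol] by simp
  have K_eq: "K = L * inv_mat (tls_P A \<sigma>)"
    unfolding K_def inv_P(1)[OF sol] using L inv_P(2,3)[OF sol]
    by (simp add: assoc_mult_mat[of _ k n _ n _ n] assoc_mult_mat[of _ n n _ n _ n])
  have K: "K \<in> carrier_mat k n" using K_eq L Pi by simp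
  define c where "c = cond_vec L A b x \<sigma>"
  define c1 where "c1 = (abs_mat K * abs_mat G * abs_mat A) *\<^sub>v abs_vec x"
  define c2 where "c2 = (abs_mat K * abs_mat (transpose_mat A)) *\<^sub>v abs_vec r"
  define c3 where "c3 = abs_mat (K * G) *\<^sub>v abs_vec b"
  have c: "c \<in> carrier_vec k"
    using L by (intro carrier_vecI) (simp add: c_def cond_vec_def)
  have c123: "c1 \<in> carrier_vec k" "c2 \<in> carrier_vec k" "c3 \<in> carrier_vec k"
    using K by (intro carrier_vecI, simp add: c1_def c2_def c3_def)+
  have le: "\<bar>c $ i\<bar> \<le> \<bar>c1 $ i\<bar> + \<bar>c2 $ i\<bar> + \<bar>c3 $ i\<bar>" if "i < k" for i
    unfolding c_def c1_def c2_def c3_def G_def r_def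
    by (rule abs_cond_vec_le[OF A b x L Pi K_eq that])
  have "inf_norm c \<le> inf_norm c1 + inf_norm c2 + inf_norm c3"
    using c c123 le by (intro inf_norm_le_sum3[of _ k]) auto
  then have 1: "kappa_inf_rel L A b x \<sigma> \<le> kappa_inf_U L A b x S V"
    using A unfolding kappa_inf_rel_def kappa_inf_U_def Let_def
    by (auto simp: c_def c1_def c2_def c3_def K_def G_def r_def inf_norm_nonneg divide_right_mono)
  define d where "d i = inverse ((L *\<^sub>v x) $ i)" for i
  define Di where "Di = mat_diag k d"
  have Di: "Di \<in> carrier_mat k k" by (simp add: Di_def)
  have pinv: "pinv (diag_of_vec (L *\<^sub>v x)) = Di"
    using L unfolding pinv_diag_of_vec by (simp add: Di_def d_def[abs_def])
  have Di_le: "\<bar>(Di *\<^sub>v c) $ i\<bar> \<le> \<bar>(Di *\<^sub>v c1) $ i\<bar> + \<bar>(Di *\<^sub>v c2) $ i\<bar> + \<bar>(Di *\<^sub>v c3) $ i\<bar>"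
    if i: "i < k" for i
    unfolding Di_def mat_diag_mult_vec_index[OF i c] c123[THEN mat_diag_mult_vec_index[OF i]]
    using mult_left_mono[OF le[OF i], of "\<bar>d i\<bar>"] by (simp add: abs_mult distrib_left)
  have "inf_norm (Di *\<^sub>v c) \<le> inf_norm (Di *\<^sub>v c1) + inf_norm (Di *\<^sub>v c2) + inf_norm (Di *\<^sub>v c3)"
    using Di Di_le by (intro inf_norm_le_sum3[of _ k]) auto
  moreover have "Di *\<^sub>v c1 = (Di * abs_mat K * abs_mat G * abs_mat A) *\<^sub>v abs_vec x"
  proof -
    have "Di *\<^sub>v c1 = (Di * (abs_mat K * abs_mat G * abs_mat A)) *\<^sub>v abs_vec x"
      unfolding c1_def using Di K G A x by (intro assoc_mult_mat_vec[of _ k k _ n, symmetric]) auto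
    also have "Di * (abs_mat K * abs_mat G * abs_mat A) = Di * (abs_mat K * abs_mat G) * abs_mat A"
      using Di K G A by (intro assoc_mult_mat[of _ k k _ m _ n, symmetric]) auto
    also have "Di * (abs_mat K * abs_mat G) = Di * abs_mat K * abs_mat G"
      using Di K G by (intro assoc_mult_mat[of _ k k _ n _ m, symmetric]) auto
    finally show ?thesis .
  qed
  moreover have "Di *\<^sub>v c2 = (Di * abs_mat K * abs_mat (transpose_mat A)) *\<^sub>v abs_vec r"
  proof -
    have "Di *\<^sub>v c2 = (Di * (abs_mat K * abs_mat (transpose_mat A))) *\<^sub>v abs_vec r"
      unfolding c2_def using Di K A r by (intro assoc_mult_mat_vec[of _ k k _ m, symmetric]) auto
    also have "Di * (abs_mat K * abs_mat (transpose_mat A)) = Di * abs_mat K * abs_mat (transpose_mat A)"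
      using Di K A by (intro assoc_mult_mat[of _ k k _ n _ m, symmetric]) auto
    finally show ?thesis .
  qed
  moreover have "Di *\<^sub>v c3 = (Di * abs_mat (K * G)) *\<^sub>v abs_vec b"
    unfolding c3_def using Di K G b by (intro assoc_mult_mat_vec[of _ k k _ m, symmetric]) auto
  ultimately have 2: "kappa_c L A b x \<sigma> \<le> kappa_c_U L A b x S V"
    using A unfolding kappa_c_def kappa_c_U_def Let_def
    by (simp add: pinv c_def K_def G_def r_def)
  show ?thesis using 1 2 by blast
qed

end
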